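(* Let $\mathbb{D}=\{z\in\mathbb{C}:|z|<1\}$, let $z_1,z_2\in\mathbb{D}$, and let $u\in\partial\mathbb{D}=\{z\in\mathbb{C}:|z|=1\}$ satisfy $$\measuredangle(z_1,u,0)=\measuredangle(0,u,z_2).$$ Then $u$ is a solution of the equation $$\overline{z_1}\,\overline{z_2}\,u^4-(\overline{z_1}+\overline{z_2})u^3+(z_1+z_2)u-z_1z_2=0.$$
   Context: For $z,u,w\in\mathbb{C}$ with $z\ne u$ and $w\neq u$, $\measuredangle(z,u,w)$ denotes the radian measure in $(-\pi,\pi]$ of the oriented angle with initial side $[u,z]$ and final side $[u,w]$, i.e. the argument in $(-\pi,\pi]$ of $\frac{w-u}{z-u}$. *)

theory Defs
  imports "HOL-Analysis.Analysis"
begin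

(* Meaningful only for z \<noteq> u and w \<noteq> u; Arg is the principal argument, with values in (-pi, pi]. *)
definition oriented_angle :: "complex \<Rightarrow> complex \<Rightarrow> complex \<Rightarrow> real" where
  "oriented_angle z u w = Arg ((w - u) / (z - u))"

end

theory Submission
  imports Defs
begin

text \<open>Equality of the two angles makes the quotient of \<open>- u / (z1 - u)\<close> and \<open>(z2 - u) / (- u)\<close>
  real, so \<open>(z1 - u) * (z2 - u) / u\<^sup>2\<close> equals its own conjugate. Since \<open>cnj u = 1 / u\<close>, clearing
  denominators turns this into the quartic equation.\<close>

text \<open>Nonzero \<open>a\<close> and \<open>b\<close> are positive multiples of the same unit
  complex number, so \<open>a * cnj b\<close> is the real number \<open>norm a * norm b\<close>. If
  one of them is 0, both sides vanish.\<close>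

lemma Arg_eq_imp_mult_cnj_eq:
  assumes "Arg a = Arg b"
  shows "a * cnj b = cnj a * b"
proof (cases "a = 0 \<or> b = 0")
  case False
  then have a: "a = of_real (norm a) * exp (\<i> * of_real (Arg a))"
    and b: "b = of_real (norm b) * exp (\<i> * of_real (Arg a))"
    using Arg_eq[of a] Arg_eq[of b] assms by auto
  show ?thesis
    by (subst (1 2) a, subst (1 2) b) simp
qed auto

theorem theorem1p3:
  fixes z1 z2 u :: complex
  assumes "z1 \<in> ball 0 1" and "z2 \<in> ball 0 1"
    and "u \<in> sphere 0 1"
    and "oriented_angle z1 u 0 = oriented_angle 0 u z2"
  shows "cnj z1 * cnj z2 * u ^ 4 - (cnj z1 + cnj z2) * u ^ 3 + (z1 + z2) * u - z1 * z2 = 0"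
proof -
  have nz: "u \<noteq> 0" "z1 - u \<noteq> 0" "cnj z1 - cnj u \<noteq> 0"
    using assms(1,3) by auto
  have uu: "u * cnj u = 1"
    using assms(3) by (simp add: complex_norm_square[symmetric])
  have "(- u / (z1 - u)) * cnj ((z2 - u) / (- u)) = cnj (- u / (z1 - u)) * ((z2 - u) / (- u))"
    using assms(4) by (intro Arg_eq_imp_mult_cnj_eq) (simp add: oriented_angle_def)
  then have "u\<^sup>2 * (cnj z1 - cnj u) * (cnj z2 - cnj u) = (cnj u)\<^sup>2 * (z1 - u) * (z2 - u)"
    using nz by (simp add: divide_simps power2_eq_square mult_ac)
  \<comment> \<open>After multiplication by \<open>u\<^sup>2\<close>, the relation
    \<open>u * cnj u = 1\<close> gives \<open>u\<^sup>2 * (u * cnj z1 - 1) * (u * cnj z2 - 1) = (z1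
    - u) * (z2 - u)\<close>. The term \<open>u\<^sup>2\<close> on each side cancels, so the quartic
    has no quadratic term.\<close>
  with uu show ?thesis
    by algebra
qed

end
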